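(* Let $u$ be a sequence in which the first letter occurs multiple times or the last letter occurs multiple times. Then $\operatorname{Sat}(u,n)\ge n$ for every positive integer $n$.
   Context: Sequences are finite words over an alphabet; a sequence on a given alphabet takes its letters from that alphabet (not every letter is required to appear). Two sequences are isomorphic if one is obtained from the other by a one-to-one renaming of letters. A sequence contains a copy of $u$ if some (not necessarily contiguous) subsequence of it is isomorphic to $u$; otherwise it is $u$-free. For a positive integer $m$, a sequence is $m$-sparse if any $m$ consecutive letters are distinct, meaning that any two occurrences of the same letter are at positions differing by at least $m$ (also for sequences shorter than $m$). Let $\|u\|$ be the number of distinct letters of $u$. A sequence $s$ on a given alphabet is $u$-saturated if $s$ is $\|u\|$-sparse, $u$-free, and inserting any letter of the alphabet at any position of $s$ (including the beginning or the end) violates $\|u\|$-sparsity or creates a copy of $u$. $\operatorname{Sat}(u,n)$ is the minimum possible length of a $u$-saturated sequence on an alphabet of size $n$. *)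

theory Defs
  imports Main "HOL-Library.Sublist"
begin

text \<open>Sequences are lists. The forbidden pattern and the sequence may have letters of
  different types, since isomorphism only concerns renaming.\<close>

definition isomorphic :: "'a list \<Rightarrow> 'b list \<Rightarrow> bool" where
  "isomorphic u v \<longleftrightarrow> (\<exists>f. inj_on f (set u) \<and> v = map f u)"

definition contains_copy :: "'b list \<Rightarrow> 'a list \<Rightarrow> bool" where
  "contains_copy s u \<longleftrightarrow> (\<exists>v. subseq v s \<and> isomorphic u v)"

definition sparse :: "nat \<Rightarrow> 'b list \<Rightarrow> bool" where
  "sparse m s \<longleftrightarrow> (\<forall>i j. i < j \<and> j < length s \<and> s ! i = s ! j \<longrightarrow> m \<le> j - i)"

definition num_letters :: "'a list \<Rightarrow> nat" where
  "num_letters u = card (set u)"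

definition insert_letter :: "nat \<Rightarrow> 'b \<Rightarrow> 'b list \<Rightarrow> 'b list" where
  "insert_letter i a s = take i s @ a # drop i s"

definition saturated :: "'b set \<Rightarrow> 'a list \<Rightarrow> 'b list \<Rightarrow> bool" where
  "saturated A u s \<longleftrightarrow>
     set s \<subseteq> A \<and> sparse (num_letters u) s \<and> \<not> contains_copy s u \<and>
     (\<forall>a\<in>A. \<forall>i\<le>length s.
        \<not> sparse (num_letters u) (insert_letter i a s) \<or> contains_copy (insert_letter i a s) u)"

text \<open>Letters can be taken to be natural numbers without loss of generality. An infimum of
  natural numbers is a minimum when the set is nonempty; the infimum of the empty set is 0, so a
  positive lower bound on \<open>Sat u n\<close> entails that a saturated sequence exists.\<close>

definition Sat :: "'a list \<Rightarrow> nat \<Rightarrow> nat" where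
  "Sat u n = Inf {length s | (s :: nat list) A. finite A \<and> card A = n \<and> saturated A u s}"

end

theory Submission
  imports Defs
begin

text \<open>
  Every saturated sequence must use every letter of its alphabet, which gives the lower bound.
  Suppose that a letter \<open>a\<close> does not occur in \<open>s\<close>. Inserting a fresh letter anywhere keeps \<open>s\<close>
  sparse, so by saturation it must create a copy of \<open>u\<close>, and that copy must use \<open>a\<close>. If the first
  letter of \<open>u\<close> is repeated, insert \<open>a\<close> at the beginning: it then plays the role of the first letter
  of \<open>u\<close>, which is impossible because it occurs only once (\<open>copy_in_Cons_fresh\<close>). If the last
  letter is repeated, insert \<open>a\<close> at the end and reverse everything.

  Since an infimum over the empty set would be \<open>0\<close>, the bound also needs that a saturated sequence
  exists. A longest sparse \<open>u\<close>-free sequence on the alphabet is saturated, so it suffices to bound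
  the lengths of such sequences. Cut the sequence into consecutive blocks whose length is the number
  of letters of \<open>u\<close>. By sparsity each block has distinct letters, and there are only finitely many
  possible blocks; hence in a long enough sequence some block repeats at least as many times as \<open>u\<close>
  has positions. Taking one letter from each repetition then spells out a copy of \<open>u\<close>
  (\<open>sparse_free_length_bound\<close>).
\<close>

section \<open>Inserting a fresh letter at an end\<close>

lemma subseq_rev: "subseq xs ys \<Longrightarrow> subseq (rev xs) (rev ys)"
  by (induction rule: list_emb.induct) (auto intro: subseq_rev_drop_many list_emb_append_mono)

lemma contains_copy_rev:
  fixes s :: "'b list" and u :: "'a list"
  shows "contains_copy (rev s) (rev u) \<longleftrightarrow> contains_copy s u"
proof -
  have *: "contains_copy (rev s) (rev u)"
    if copy: "contains_copy s u" for s :: "'b list" and u :: "'a list"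
  proof -
    obtain f where "subseq (map f u) s" "inj_on f (set u)"
      using copy unfolding contains_copy_def isomorphic_def by auto
    then have "subseq (map f (rev u)) (rev s)" "inj_on f (set (rev u))"
      using subseq_rev[of "map f u" s] by (simp_all add: rev_map)
    then show ?thesis
      unfolding contains_copy_def isomorphic_def by blast
  qed
  show ?thesis
    using *[of s u] *[of "rev s" "rev u"] by auto
qed

text \<open>A copy that used the prepended letter would have it in first position, and would then need a
  second occurrence of it.\<close>

lemma copy_in_Cons_fresh:
  assumes copy: "contains_copy (a # s) u" and fresh: "a \<notin> set s"
    and nonempty: "u \<noteq> []" and repeated: "count_list u (hd u) \<ge> 2"
  shows "contains_copy s u"
proof -
  obtain f where f: "subseq (map f u) (a # s)" "inj_on f (set u)"
    using copy unfolding contains_copy_def isomorphic_def by auto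
  obtain x xs where u: "u = x # xs"
    using nonempty by (cases u) auto
  have "x \<in> set xs"
    using repeated u count_notin[of x xs] by (cases "x \<in> set xs") auto
  moreover have "subseq (map f xs) s" if "f x = a"
    using f(1) that u by simp
  ultimately have "f x \<noteq> a"
    using fresh list_emb_set[of "(=)" "map f xs" s "f x"] by auto
  then have "subseq (map f u) s"
    using f(1) u by simp
  then show ?thesis
    using f(2) unfolding contains_copy_def isomorphic_def by blast
qed

lemma copy_in_snoc_fresh:
  assumes "contains_copy (s @ [a]) u" "a \<notin> set s"
    and "u \<noteq> []" "count_list u (last u) \<ge> 2"
  shows "contains_copy s u"
proof -
  have "contains_copy (a # rev s) (rev u)"
    using assms(1) contains_copy_rev[of "s @ [a]" u] by simp
  then have "contains_copy (rev s) (rev u)"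
    by (rule copy_in_Cons_fresh) (use assms in \<open>simp_all add: hd_rev\<close>)
  then show ?thesis
    by (simp add: contains_copy_rev)
qed

lemma sparse_Cons_fresh:
  assumes "sparse m s" "a \<notin> set s"
  shows "sparse m (a # s)"
  unfolding sparse_def
proof (intro allI impI, elim conjE)
  fix i j
  assume ij: "i < j" "j < length (a # s)" "(a # s) ! i = (a # s) ! j"
  then obtain j' where j: "j = Suc j'" "j' < length s"
    by (cases j) auto
  then obtain i' where i: "i = Suc i'"
    using ij assms(2) by (cases i) auto
  show "m \<le> j - i"
    using assms(1) ij i j unfolding sparse_def by auto
qed

lemma sparse_snoc_fresh:
  assumes "sparse m s" "a \<notin> set s"
  shows "sparse m (s @ [a])"
  using assms unfolding sparse_def
  by (auto simp: nth_append less_Suc_eq)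

lemma saturated_uses_all_letters:
  assumes sat: "saturated A u s" and nonempty: "u \<noteq> []"
    and repeated: "count_list u (hd u) \<ge> 2 \<or> count_list u (last u) \<ge> 2"
  shows "set s = A"
proof
  show "set s \<subseteq> A"
    using sat by (simp add: saturated_def)
  have sparse: "sparse (num_letters u) s" and free: "\<not> contains_copy s u"
    using sat by (simp_all add: saturated_def)
  have insertion: "\<not> sparse (num_letters u) (insert_letter i a s) \<or>
      contains_copy (insert_letter i a s) u" if "a \<in> A" "i \<le> length s" for a i
    using sat that by (simp add: saturated_def)
  show "A \<subseteq> set s"
  proof (rule subsetI, rule ccontr)
    fix a assume a: "a \<in> A" "a \<notin> set s"
    have "contains_copy (a # s) u"
      using insertion[OF a(1), of 0] sparse_Cons_fresh[OF sparse a(2)]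
      by (simp add: insert_letter_def)
    moreover have "contains_copy (s @ [a]) u"
      using insertion[OF a(1), of "length s"] sparse_snoc_fresh[OF sparse a(2)]
      by (simp add: insert_letter_def)
    ultimately show False
      using copy_in_Cons_fresh copy_in_snoc_fresh a(2) nonempty repeated free by metis
  qed
qed

section \<open>Existence of saturated sequences\<close>

lemma sparse_block_distinct:
  assumes "sparse m s"
  shows "distinct (take m (drop k s))"
  unfolding distinct_conv_nth
proof (intro allI impI)
  fix i j
  assume ij: "i < length (take m (drop k s))" "j < length (take m (drop k s))" "i \<noteq> j"
  have "take m (drop k s) ! i \<noteq> take m (drop k s) ! j"
    if "i < j" "j < length (take m (drop k s))" for i j
  proof
    assume "take m (drop k s) ! i = take m (drop k s) ! j"
    then have "s ! (k + i) = s ! (k + j)" "k + j < length s" "j < m"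
      using that by auto
    then have "m \<le> (k + j) - (k + i)"
      using assms \<open>i < j\<close> unfolding sparse_def by (meson add_less_cancel_left)
    then show False
      using \<open>j < m\<close> \<open>i < j\<close> by simp
  qed
  then show "take m (drop k s) ! i \<noteq> take m (drop k s) ! j"
    using ij by (metis nat_neq_iff)
qed

lemma concat_blocks: "concat (map (\<lambda>j. take m (drop (j * m) s)) [0..<N]) = take (N * m) s"
proof (induction N)
  case (Suc N)
  have "take (Suc N * m) s = take (N * m) s @ take m (drop (N * m) s)"
    using take_add[of "N * m" m s] by (simp add: add.commute)
  then show ?case
    using Suc by simp
qed simp

lemma subseq_concat_filter: "subseq (concat (filter P ws)) (concat ws)"
  by (induction ws) (auto intro: list_emb_append2 list_emb_append_mono)

lemma subseq_concat_replicate: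
  assumes "set v \<subseteq> set w"
  shows "subseq v (concat (replicate (length v) w))"
  using assms
proof (induction v)
  case (Cons x v)
  have "subseq ([x] @ v) (w @ concat (replicate (length v) w))"
    using Cons by (intro list_emb_append_mono) (auto simp: subseq_singleton_left)
  then show ?case
    by simp
qed simp

text \<open>The repetitions of \<open>w\<close> offer, for each position of \<open>u\<close> in turn, a fresh supply of all the
  letters needed, so any bijective renaming of the letters of \<open>u\<close> into those of \<open>w\<close> works.\<close>

lemma contains_copy_if_block_repeats:
  assumes "distinct w" "length w = num_letters u" "count_list ws w \<ge> length u"
    and "subseq (concat ws) s"
  shows "contains_copy s u"
proof -
  have "card (set u) = card (set w)"
    using assms(1,2) by (simp add: distinct_card num_letters_def)
  then obtain g where g: "bij_betw g (set u) (set w)"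
    using finite_same_card_bij[of "set u" "set w"] by auto
  let ?c = "count_list ws w"
  have filter: "filter ((=) w) ws = replicate ?c w"
    by (induction ws) auto
  have split: "replicate ?c w = replicate (length u) w @ replicate (?c - length u) w"
    using assms(3) by (simp flip: replicate_add)
  have "set (map g u) \<subseteq> set w"
    using g by (auto simp: bij_betw_def)
  then have "subseq (map g u) (concat (replicate (length u) w))"
    using subseq_concat_replicate[of "map g u" w] by simp
  also have "subseq \<dots> (concat (replicate ?c w))"
    unfolding split by (simp add: subseq_rev_drop_many)
  also have "subseq \<dots> (concat ws)"
    using subseq_concat_filter[of "(=) w" ws] filter by simp
  also have "subseq \<dots> s"
    by (fact assms(4))
  finally show ?thesis
    using g unfolding contains_copy_def isomorphic_def bij_betw_def by blast
qed

lemma pigeonhole_count_list: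
  assumes "finite B" "set ws \<subseteq> B" "length ws > card B * k"
  shows "\<exists>w\<in>set ws. count_list ws w > k"
proof (rule ccontr)
  assume "\<not> ?thesis"
  then have "count_list ws w \<le> k" for w
    by (cases "w \<in> set ws") (auto simp: not_less)
  then have "(\<Sum>w\<in>B. count_list ws w) \<le> card B * k"
    using sum_bounded_above[of B "count_list ws" k] by simp
  then show False
    using sum_count_set[OF assms(2,1)] assms(3) by simp
qed

text \<open>The pigeonhole principle applied to the consecutive blocks of length \<open>num_letters u\<close>, each of
  which is one of the finitely many words of that length over the alphabet.\<close>

lemma sparse_free_length_bound:
  fixes u :: "'a list" and A :: "'b set"
  assumes "finite A"
  shows "\<exists>L. \<forall>s. set s \<subseteq> A \<and> sparse (num_letters u) s \<and> \<not> contains_copy s u \<longrightarrow> length s < L"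
proof -
  define m where "m = num_letters u"
  define B where "B = {w. set w \<subseteq> A \<and> length w = m}"
  define N where "N = Suc (card B * length u)"
  have "finite B"
    unfolding B_def using assms by (rule finite_lists_length_eq)
  have "contains_copy s u"
    if s: "set s \<subseteq> A" "sparse m s" "length s \<ge> N * m" for s :: "'b list"
  proof -
    define ws where "ws = map (\<lambda>j. take m (drop (j * m) s)) [0..<N]"
    have block: "distinct w \<and> w \<in> B" if w: "w \<in> set ws" for w
    proof -
      obtain j where j: "j < N" "w = take m (drop (j * m) s)"
        using w unfolding ws_def by auto
      have "Suc j * m \<le> length s"
        using j(1) s(3) mult_le_mono1[of "Suc j" N m] by linarith
      then have "length w = m"
        using j(2) by simp
      moreover have "set w \<subseteq> A"
        using s(1) j(2) set_take_subset set_drop_subset by fast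
      ultimately show ?thesis
        using sparse_block_distinct[OF s(2)] j(2) by (simp add: B_def)
    qed
    have "length ws > card B * length u"
      by (simp add: ws_def N_def)
    then obtain w where w: "w \<in> set ws" "count_list ws w > length u"
      using pigeonhole_count_list[OF \<open>finite B\<close>, of ws] block by blast
    have "subseq (concat ws) s"
      unfolding ws_def concat_blocks by (rule prefix_imp_subseq[OF take_is_prefix])
    then show ?thesis
      using contains_copy_if_block_repeats[of w u ws s] w block[OF w(1)]
      by (simp add: B_def m_def)
  qed
  then show ?thesis
    unfolding m_def by (metis not_less)
qed

text \<open>A sparse \<open>u\<close>-free sequence of maximal length is saturated, since every insertion makes it
  longer.\<close>

lemma saturated_exists:
  fixes u :: "'a list" and A :: "'b set"
  assumes "finite A" "u \<noteq> []"
  shows "\<exists>s. saturated A u s"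
proof -
  define good where
    "good s \<longleftrightarrow> set s \<subseteq> A \<and> sparse (num_letters u) s \<and> \<not> contains_copy s u" for s :: "'b list"
  have "good []"
    using assms(2)
    by (auto simp: good_def sparse_def contains_copy_def isomorphic_def dest: list_emb_Nil2)
  moreover obtain L where "\<forall>s. good s \<longrightarrow> length s < L"
    using sparse_free_length_bound[OF assms(1), of u] unfolding good_def by blast
  ultimately obtain s where s: "good s" "\<And>t. good t \<Longrightarrow> length t \<le> length s"
    using ex_has_greatest_nat[of good "[]" length L] by (auto simp: less_imp_le)
  have "\<not> good (insert_letter i a s)" for i a
    using s(2)[of "insert_letter i a s"] by (auto simp: insert_letter_def)
  moreover have "set (insert_letter i a s) \<subseteq> A" if "a \<in> A" for i a
    using that s(1) set_take_subset[of i s] set_drop_subset[of i s]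
    by (auto simp: insert_letter_def good_def)
  ultimately show ?thesis
    using s(1) unfolding saturated_def good_def by blast
qed

section \<open>The lower bound\<close>

theorem lemma3p2:
  fixes u :: "'a list" and n :: nat
  assumes "u \<noteq> []"
    and "count_list u (hd u) \<ge> 2 \<or> count_list u (last u) \<ge> 2"
    and "n > 0"
  shows "Sat u n \<ge> n"
  unfolding Sat_def
proof (rule cInf_greatest)
  have "finite {..<n}" "card {..<n} = n"
    by simp_all
  then show "{length s | (s :: nat list) A. finite A \<and> card A = n \<and> saturated A u s} \<noteq> {}"
    using saturated_exists[of "{..<n}" u] assms(1) by blast
next
  fix l
  assume "l \<in> {length s | (s :: nat list) A. finite A \<and> card A = n \<and> saturated A u s}"
  then obtain s :: "nat list" and A where "l = length s" "card A = n" "saturated A u s"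
    by blast
  then show "n \<le> l"
    using saturated_uses_all_letters[OF _ assms(1,2)] card_length[of s] by blast
qed

end
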